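(* Let $a,c$ be positive integers with $a<c$. For integers $s\ge1$ and $k\ge1$, let $A_s(k)$ be the number of lattice paths from $(0,0)$ to $(x_s,y_s)=(cs-1,\,as-1)$ with East steps $(1,0)$ and North steps $(0,1)$ that stay strictly below the line $y=\frac{a}{c}x+\frac{k}{c}$. Then for every $s\ge1$ and every $\ell\in\mathbb{N}$ such that $(\ell+1)a<c$, $$\sum_{k=\ell a+1}^{(\ell+1)a}A_s(k)=\frac{\ell a+c}{(a+c)s+\ell-1}\binom{(a+c)s+\ell-1}{as-1}.$$
   Context: Here $\mathbb{N}$ contains $0$. A path stays strictly below the line if every point $(x,y)$ it visits satisfies $y<\frac{a}{c}x+\frac{k}{c}$. *)

theory Defs
  imports Complex_Main
begin

definition unit_step :: "int \<times> int \<Rightarrow> int \<times> int \<Rightarrow> bool" where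
  "unit_step p q \<longleftrightarrow> q = (fst p + 1, snd p) \<or> q = (fst p, snd p + 1)"

text \<open>A lattice path is represented by the list of all the points it visits, in order,
  endpoints included.\<close>

definition lattice_paths :: "int \<times> int \<Rightarrow> int \<times> int \<Rightarrow> (int \<times> int) list set" where
  "lattice_paths P Q =
     {ps. ps \<noteq> [] \<and> hd ps = P \<and> last ps = Q \<and> successively unit_step ps}"

definition strictly_below :: "real \<Rightarrow> real \<Rightarrow> (int \<times> int) list \<Rightarrow> bool" where
  "strictly_below m b ps \<longleftrightarrow> (\<forall>(x, y) \<in> set ps. real_of_int y < m * real_of_int x + b)"

text \<open>The number \<open>A\<^sub>s(k)\<close>, with its dependence on \<open>a\<close> and \<open>c\<close> made explicit.\<close>

definition num_paths :: "nat \<Rightarrow> nat \<Rightarrow> nat \<Rightarrow> nat \<Rightarrow> nat" where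
  "num_paths a c s k =
     card {ps \<in> lattice_paths (0, 0) (int (c * s) - 1, int (a * s) - 1).
             strictly_below (real a / real c) (real k / real c) ps}"

end

theory Submission
  imports Defs
begin

text \<open>Weigh East steps by \<open>a\<close> and North steps by \<open>-c\<close>: staying strictly below the line means that
  the partial sums, started at \<open>k\<close>, stay positive. Since \<open>(l + 1) * a < c\<close>, prepending \<open>l + 1\<close> East
  steps turns the sum over \<open>k\<close> into a count of pairs \<open>(w, j)\<close>, where \<open>-a < j \<le> 0\<close> and the word
  \<open>w\<close>, of total weight \<open>l * a + c\<close>, leads from height \<open>j\<close> through positive heights only. For fixed
  \<open>w\<close> the number of admissible \<open>j\<close> is the amount by which the future minimum of the periodic
  extension of \<open>w\<close> rises in the first step. Summed over all rotations of \<open>w\<close> these increments telescope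
  to the total weight, whence the number of pairs is \<open>l * a + c\<close> over the length of the words times
  the number of words.\<close>

subsection \<open>A cycle lemma\<close>

text \<open>Since \<open>T\<close> is non-negative, the minimum over a window of length
  \<open>n\<close> is the minimum of all values from its left end on. Each summand is the increment
  of this future minimum, so the sum telescopes.\<close>

lemma sum_future_min_increments:
  fixes S :: "nat \<Rightarrow> int"
  assumes "0 < n" and "0 \<le> T" and per: "\<And>i. S (i + n) = S i + T"
  shows "(\<Sum>i<n. max 0 (Min (S ` {i + 1..i + n}) - S i)) = T"
proof -
  define M where "M i = Min (S ` {i..<i + n})" for i
  have M_Suc: "M (Suc i) = Min (S ` {i + 1..i + n})" for i
    unfolding M_def by (rule arg_cong[of _ _ "\<lambda>X. Min (S ` X)"]) auto
  \<comment> \<open>Both sides equal the minimum over \<open>{i..i + n}\<close>: the extra last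
    value \<open>S i + T\<close> is at least \<open>S i\<close> and cannot lower it.\<close>
  have M_rec: "M i = min (S i) (M (Suc i))" for i
  proof -
    have "min (S i) (M (Suc i)) = Min (insert (S i) (S ` {Suc i..<Suc i + n}))"
      unfolding M_def using \<open>0 < n\<close> by simp
    also have "insert (S i) (S ` {Suc i..<Suc i + n}) = insert (S (i + n)) (S ` {i..<i + n})"
    proof -
      have "insert i {Suc i..<Suc i + n} = insert (i + n) {i..<i + n}"
        using \<open>0 < n\<close> by auto
      then show ?thesis by (metis image_insert)
    qed
    also have "Min \<dots> = min (S i + T) (M i)"
      unfolding M_def using \<open>0 < n\<close> per by simp
    also have "\<dots> = M i"
    proof -
      have "M i \<le> S i" unfolding M_def using \<open>0 < n\<close> by simp
      then show ?thesis using \<open>0 \<le> T\<close> by simp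
    qed
    finally show ?thesis by simp
  qed
  have "M n = M 0 + T"
  proof -
    have "S ` {n..<n + n} = (\<lambda>x. x + T) ` S ` {0..<n}"
    proof -
      have "{n..<n + n} = (\<lambda>i. i + n) ` {0..<n}" by simp
      then show ?thesis by (simp only: image_image per)
    qed
    then show ?thesis
      unfolding M_def using \<open>0 < n\<close>
      by (simp add: mono_Min_commute[where f = "\<lambda>x. x + T", symmetric] mono_def)
  qed
  moreover have "max 0 (Min (S ` {i + 1..i + n}) - S i) = M (Suc i) - M i" for i
    unfolding M_Suc[symmetric] using M_rec[of i] by simp
  ultimately show ?thesis
    by (simp add: sum_lessThan_telescope)
qed

subsection \<open>Words and their heights\<close>

text \<open>In a word, \<open>True\<close> encodes an East step and \<open>False\<close> a North step.\<close>

definition words :: "nat \<Rightarrow> nat \<Rightarrow> bool list set" where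
  "words e m = {w. count_list w True = e \<and> count_list w False = m}"

definition weight :: "nat \<Rightarrow> nat \<Rightarrow> bool \<Rightarrow> int" where
  "weight a c b = (if b then int a else - int c)"

text \<open>Reading the word periodically turns a rotation into a mere shift of the
  argument.\<close>

definition height :: "nat \<Rightarrow> nat \<Rightarrow> bool list \<Rightarrow> nat \<Rightarrow> int" where
  "height a c w k = (\<Sum>i<k. weight a c (w ! (i mod length w)))"

definition stays_pos :: "nat \<Rightarrow> nat \<Rightarrow> int \<Rightarrow> bool list \<Rightarrow> bool" where
  "stays_pos a c h w \<longleftrightarrow> (\<forall>k\<le>length w. 0 < h + height a c w k)"

lemma length_words: "w \<in> words e m \<Longrightarrow> length w = e + m"
proof -
  have "count_list w True + count_list w False = length w" by (induction w) auto
  then show "w \<in> words e m \<Longrightarrow> length w = e + m" by (auto simp: words_def)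
qed

lemma finite_words: "finite (words e m)"
proof (rule finite_subset)
  show "words e m \<subseteq> {w. set w \<subseteq> UNIV \<and> length w = e + m}"
    using length_words by auto
qed (rule finite_lists_length_eq, simp)

lemma Cons_in_words:
  "True # w \<in> words e m \<longleftrightarrow> (\<exists>e'. e = Suc e' \<and> w \<in> words e' m)"
  "False # w \<in> words e m \<longleftrightarrow> (\<exists>m'. m = Suc m' \<and> w \<in> words e m')"
  by (auto simp: words_def)

lemma words_0_0: "words 0 0 = {[]}"
  and words_Suc_0: "words (Suc e) 0 = Cons True ` words e 0"
  and words_0_Suc: "words 0 (Suc m) = Cons False ` words 0 m"
  and words_Suc_Suc:
    "words (Suc e) (Suc m) = Cons True ` words e (Suc m) \<union> Cons False ` words (Suc e) m"
proof -
  have *: "w \<in> words e' m' \<longleftrightarrow> w = [] \<and> e' = 0 \<and> m' = 0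
      \<or> (\<exists>u e''. w = True # u \<and> e' = Suc e'' \<and> u \<in> words e'' m')
      \<or> (\<exists>u m''. w = False # u \<and> m' = Suc m'' \<and> u \<in> words e' m'')" for w e' m'
  proof (cases w)
    case (Cons b u)
    then show ?thesis by (cases b) (simp_all add: Cons_in_words)
  qed (auto simp: words_def)
  show "words 0 0 = {[]}" by (rule set_eqI, subst *) auto
  show "words (Suc e) 0 = Cons True ` words e 0" by (rule set_eqI, subst *) auto
  show "words 0 (Suc m) = Cons False ` words 0 m" by (rule set_eqI, subst *) auto
  show "words (Suc e) (Suc m) = Cons True ` words e (Suc m) \<union> Cons False ` words (Suc e) m"
    by (rule set_eqI, subst *) auto
qed

text \<open>Splitting by the first letter gives Pascal's rule.\<close>

lemma card_words: "card (words e m) = (e + m) choose m"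
proof (induction "e + m" arbitrary: e m)
  case 0
  then show ?case by (simp add: words_0_0)
next
  case (Suc n)
  consider e' where "e = Suc e'" "m = 0" | m' where "e = 0" "m = Suc m'"
    | e' m' where "e = Suc e'" "m = Suc m'"
    using Suc(2) by (cases e; cases m) auto
  then show ?case
  proof cases
    case 1
    then show ?thesis using Suc by (simp add: words_Suc_0 card_image)
  next
    case 2
    then show ?thesis using Suc by (simp add: words_0_Suc card_image)
  next
    case 3
    then have "card (words e m) = card (words e' (Suc m')) + card (words (Suc e') m')"
      by (simp add: words_Suc_Suc)
        (subst card_Un_disjoint, auto simp: finite_words card_image)
    then show ?thesis using 3 Suc(1)[of e' "Suc m'"] Suc(1)[of "Suc e'" m'] Suc(2) by simp
  qed
qed

lemma rotate_words: "rotate i w \<in> words e m \<longleftrightarrow> w \<in> words e m"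
proof -
  have "count_list (rotate1 u) b = count_list u b" for u and b :: bool
    by (cases u) auto
  then have "count_list (rotate i w) b = count_list w b" for b
    by (induction i) auto
  then show ?thesis by (simp add: words_def)
qed

text \<open>Permuting all words at once allows averaging over rotations without choosing orbits, so
  words with a nontrivial period need no special care.\<close>

lemma bij_betw_rotate_words: "bij_betw (rotate i) (words e m) (words e m)"
proof -
  have "inj (rotate i :: bool list \<Rightarrow> bool list)"
    unfolding rotate_def by (rule inj_fn[OF inj_rotate1])
  then have "inj_on (rotate i) (words e m)" by (rule inj_on_subset) simp
  moreover have "rotate i ` words e m \<subseteq> words e m" by (auto simp: rotate_words)
  ultimately show ?thesis
    by (simp add: bij_betw_def endo_inj_surj[OF finite_words])
qed

lemma height_Cons:
  "k \<le> length w \<Longrightarrow> height a c (b # w) (Suc k) = weight a c b + height a c w k"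
  unfolding height_def by (simp add: sum.lessThan_Suc_shift del: sum.lessThan_Suc)

lemma height_length:
  assumes "w \<in> words e m"
  shows "height a c w (length w) = int (a * e) - int (c * m)"
proof -
  have "height a c w (length w) = int (a * count_list w True) - int (c * count_list w False)"
  proof (induction w)
    case (Cons b w)
    then show ?case by (simp add: height_Cons weight_def algebra_simps)
  qed (simp add: height_def)
  then show ?thesis using assms by (simp add: words_def)
qed

lemma height_add_length: "height a c w (i + length w) = height a c w i + height a c w (length w)"
  by (induction i) (simp_all add: height_def)

lemma height_rotate:
  assumes "w \<noteq> []"
  shows "height a c (rotate i w) k = height a c w (i + k) - height a c w i"
proof (induction k)
  case (Suc k)
  have "rotate i w ! (k mod length w) = w ! ((i + k) mod length w)"
    using assms by (simp add: nth_rotate mod_add_right_eq)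
  then show ?case using Suc by (simp add: height_def)
qed (simp add: height_def)

lemma stays_pos_Nil: "stays_pos a c h [] \<longleftrightarrow> 0 < h"
  by (simp add: stays_pos_def height_def)

lemma stays_pos_Cons:
  "stays_pos a c h (b # w) \<longleftrightarrow> 0 < h \<and> stays_pos a c (h + weight a c b) w"
proof -
  have "stays_pos a c h (b # w) \<longleftrightarrow>
      0 < h \<and> (\<forall>k\<le>length w. 0 < h + height a c (b # w) (Suc k))"
    unfolding stays_pos_def
    by (auto simp: height_def All_less_Suc2 less_Suc_eq_le[symmetric] simp del: sum.lessThan_Suc)
  then show ?thesis by (simp add: stays_pos_def height_Cons add.assoc)
qed

lemma stays_pos_imp_pos: "stays_pos a c h w \<Longrightarrow> 0 < h"
  by (cases w) (auto simp: stays_pos_Nil stays_pos_Cons)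

subsection \<open>Counting pairs of a word and a starting height\<close>

text \<open>The start itself is exempt from positivity: in a nonempty word the first step has to
  cross from a non-positive to a positive height.\<close>

definition starts :: "nat \<Rightarrow> nat \<Rightarrow> bool list \<Rightarrow> int set" where
  "starts a c w = {j. j \<le> 0 \<and> (\<forall>k\<in>{1..length w}. 0 < j + height a c w k)}"

text \<open>With \<open>?M\<close> the least later height, the admissible \<open>j\<close> are those
  with \<open>0 \<le> -j < ?M\<close>.\<close>

lemma card_starts:
  assumes "w \<noteq> []"
  shows "int (card (starts a c w)) = max 0 (Min (height a c w ` {1..length w}))"
proof -
  let ?M = "Min (height a c w ` {1..length w})"
  have "(\<forall>k\<in>{1..length w}. - j < height a c w k) \<longleftrightarrow> - j < ?M" for j
    using assms by (subst Min_gr_iff) (auto simp: Suc_le_eq)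
  moreover have "0 < j + x \<longleftrightarrow> - j < x" for j x :: int by auto
  ultimately have "starts a c w = {- ?M<..0}"
    unfolding starts_def by auto
  then show ?thesis by simp
qed

text \<open>The heights of the \<open>i\<close>-th rotation are those of \<open>w\<close> on the
  window after \<open>i\<close>, lowered by \<open>?S i\<close>; its count is thus the
  \<open>i\<close>-th increment of the future minimum.\<close>

lemma sum_card_starts_rotate:
  assumes "w \<noteq> []" and "0 \<le> height a c w (length w)"
  shows "(\<Sum>i<length w. int (card (starts a c (rotate i w)))) = height a c w (length w)"
proof -
  let ?n = "length w" and ?S = "height a c w"
  have "int (card (starts a c (rotate i w))) = max 0 (Min (?S ` {i + 1..i + ?n}) - ?S i)" for i
  proof -
    have "height a c (rotate i w) ` {1..?n} = (\<lambda>x. x - ?S i) ` ?S ` {i + 1..i + ?n}"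
    proof -
      have "{i + 1..i + ?n} = (\<lambda>k. i + k) ` {1..?n}" by simp
      moreover have "height a c (rotate i w) = (\<lambda>k. ?S (i + k) - ?S i)"
        using height_rotate[OF assms(1)] by blast
      ultimately show ?thesis by (simp only: image_image)
    qed
    then show ?thesis using assms(1)
      by (simp add: card_starts Suc_le_eq mono_def
          mono_Min_commute[where f = "\<lambda>x. x - ?S i", symmetric])
  qed
  moreover have "(\<Sum>i<?n. max 0 (Min (?S ` {i + 1..i + ?n}) - ?S i)) = ?S ?n"
    using assms by (intro sum_future_min_increments height_add_length) auto
  ultimately show ?thesis by simp
qed

text \<open>Double counting over pairs of a word and a rotation index: each index gives the same sum
  over words, and each word contributes its total weight.\<close>

lemma sum_card_starts:
  assumes "0 < e + m" and "0 \<le> int (a * e) - int (c * m)"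
  shows "int (e + m) * (\<Sum>w\<in>words e m. int (card (starts a c w))) =
         (int (a * e) - int (c * m)) * int ((e + m) choose m)"
proof -
  let ?G = "\<lambda>w. int (card (starts a c w))"
  have "int (e + m) * (\<Sum>w\<in>words e m. ?G w) = (\<Sum>i<e + m. \<Sum>w\<in>words e m. ?G w)" by simp
  also have "\<dots> = (\<Sum>i<e + m. \<Sum>w\<in>words e m. ?G (rotate i w))"
    by (rule sum.cong[OF refl]) (rule sum.reindex_bij_betw[OF bij_betw_rotate_words, symmetric])
  also have "\<dots> = (\<Sum>w\<in>words e m. \<Sum>i<e + m. ?G (rotate i w))" by (rule sum.swap)
  also have "\<dots> = (\<Sum>w\<in>words e m. int (a * e) - int (c * m))"
  proof (rule sum.cong[OF refl])
    fix w assume w: "w \<in> words e m"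
    then show "(\<Sum>i<e + m. ?G (rotate i w)) = int (a * e) - int (c * m)"
      using sum_card_starts_rotate[of w a c] length_words[OF w] height_length[OF w, of a c] assms
      by fastforce
  qed
  finally show ?thesis by (simp add: card_words)
qed

lemma starts_Cons_True:
  "starts a c (True # w) = {j \<in> {- int a<..0}. stays_pos a c (j + int a) w}"
proof -
  have "(\<forall>k\<in>{1..length (True # w)}. 0 < j + height a c (True # w) k) \<longleftrightarrow>
      (\<forall>k\<le>length w. 0 < j + height a c (True # w) (Suc k))" for j
    by (auto simp: Ball_def) (metis Suc_le_D Suc_le_mono)
  then have "starts a c (True # w) = {j. j \<le> 0 \<and> stays_pos a c (j + int a) w}"
    by (simp add: starts_def stays_pos_def height_Cons weight_def add.assoc)
  then show ?thesis using stays_pos_imp_pos by fastforce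
qed

lemma starts_Cons_False: "starts a c (False # w) = {}"
  by (force simp: starts_def height_def weight_def)

text \<open>Only words beginning with East contribute. Deleting that step leaves a word that starts
  at height \<open>j + a\<close>, which ranges over \<open>{1..a}\<close>.\<close>

lemma sum_card_starts_eq_sum_card_stays_pos:
  "(\<Sum>w\<in>words (Suc e) m. card (starts a c w)) =
   (\<Sum>j\<in>{1..a}. card {w \<in> words e m. stays_pos a c (int j) w})"
proof -
  have "(\<Sum>w\<in>words (Suc e) m. card (starts a c w)) =
      (\<Sum>w\<in>Cons True ` words e m. card (starts a c w))"
  proof (rule sum.mono_neutral_right)
    show "Cons True ` words e m \<subseteq> words (Suc e) m" by (auto simp: words_def)
    show "\<forall>w\<in>words (Suc e) m - Cons True ` words e m. card (starts a c w) = 0"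
    proof
      fix w assume "w \<in> words (Suc e) m - Cons True ` words e m"
      then obtain u where "w = False # u"
        by (cases w) (auto simp: words_def image_iff split: if_splits)
      then show "card (starts a c w) = 0" by (simp add: starts_Cons_False)
    qed
  qed (rule finite_words)
  also have "\<dots> = (\<Sum>w\<in>words e m. card (starts a c (True # w)))"
    by (simp add: sum.reindex)
  also have "\<dots> = (\<Sum>w\<in>words e m. \<Sum>j\<in>{- int a<..0}. of_bool (stays_pos a c (j + int a) w))"
    by (simp add: starts_Cons_True Int_def)
  also have "\<dots> = (\<Sum>w\<in>words e m. \<Sum>j\<in>{1..a}. of_bool (stays_pos a c (int j) w))"
    by (intro sum.cong[OF refl] sum.reindex_bij_witness[of _ "\<lambda>j. int j - int a" "\<lambda>j. nat (j + int a)"])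
      auto
  also have "\<dots> = (\<Sum>j\<in>{1..a}. \<Sum>w\<in>words e m. of_bool (stays_pos a c (int j) w))"
    by (rule sum.swap)
  also have "\<dots> = (\<Sum>j\<in>{1..a}. card {w \<in> words e m. stays_pos a c (int j) w})"
    by (simp add: finite_words Int_def)
  finally show ?thesis .
qed

text \<open>From a height at most \<open>c\<close> a North step would end at a non-positive height, so East steps are forced.\<close>

lemma card_stays_pos_forced_East:
  assumes "0 < h" and "h + int (l * a) \<le> int c + int a"
  shows "card {w \<in> words (e + l) m. stays_pos a c h w} =
         card {w \<in> words e m. stays_pos a c (h + int (l * a)) w}"
  using assms
proof (induction l arbitrary: h)
  case (Suc l)
  \<comment> \<open>The bound for \<open>Suc l\<close> contains one more \<open>a\<close>, which
    cancels the \<open>a\<close> on its right side and leaves \<open>h \<le> c\<close>; a North step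
    would then reach \<open>h - c \<le> 0\<close>.\<close>
  have "0 \<le> int (l * a)" by simp
  then have "h \<le> int c" using Suc.prems unfolding mult_Suc of_nat_add by linarith
  have "w \<in> words (e + Suc l) m \<and> stays_pos a c h w \<longleftrightarrow>
      w \<in> Cons True ` {w \<in> words (e + l) m. stays_pos a c (h + int a) w}" for w
  proof (cases w)
    case (Cons b u)
    then show ?thesis
      using \<open>0 < h\<close> \<open>h \<le> int c\<close> stays_pos_imp_pos[of a c "h - int c" u]
      by (cases b) (auto simp: Cons_in_words stays_pos_Cons weight_def)
  qed (auto simp: words_def)
  then have "{w \<in> words (e + Suc l) m. stays_pos a c h w} =
      Cons True ` {w \<in> words (e + l) m. stays_pos a c (h + int a) w}" by auto
  then have "card {w \<in> words (e + Suc l) m. stays_pos a c h w} =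
      card {w \<in> words (e + l) m. stays_pos a c (h + int a) w}"
    by (simp add: card_image)
  then show ?case using Suc.IH[of "h + int a"] Suc.prems by (simp add: algebra_simps)
qed simp

subsection \<open>Lattice paths as words\<close>

fun path :: "int \<times> int \<Rightarrow> bool list \<Rightarrow> (int \<times> int) list" where
  "path P [] = [P]"
| "path P (b # w) = P # path (if b then (fst P + 1, snd P) else (fst P, snd P + 1)) w"

lemma path_neq_Nil: "path P w \<noteq> []"
  by (cases w) auto

lemma hd_path: "hd (path P w) = P"
  by (cases w) auto

lemma last_path:
  "last (path P w) = (fst P + int (count_list w True), snd P + int (count_list w False))"
  by (induction w arbitrary: P) (auto simp: path_neq_Nil)

lemma successively_path: "successively unit_step (path P w)"
  by (induction w arbitrary: P) (auto simp: successively_Cons path_neq_Nil hd_path unit_step_def)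

text \<open>The second point reveals the first letter, because the two unit steps end at different
  points.\<close>

lemma path_inject: "path P w = path P w' \<Longrightarrow> w = w'"
proof (induction w arbitrary: P w')
  case Nil
  then show ?case by (cases w') (simp_all add: path_neq_Nil[symmetric])
next
  case (Cons b w)
  obtain b' u where w': "w' = b' # u"
    using Cons.prems by (cases w') (simp_all add: path_neq_Nil)
  let ?Q = "\<lambda>b. if b then (fst P + 1, snd P) else (fst P, snd P + 1)"
  have eq: "path (?Q b) w = path (?Q b') u"
    using Cons.prems unfolding w' path.simps by (rule list.inject[THEN iffD1, THEN conjunct2])
  have "?Q b = ?Q b'" using arg_cong[OF eq, of hd] by (simp only: hd_path)
  then have "b = b'" by (simp split: if_splits)
  with eq Cons.IH[of "?Q b" u] show ?case by (simp only: w')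
qed

lemma successively_unit_step_imp_path:
  "successively unit_step (P # ps) \<Longrightarrow> \<exists>w. P # ps = path P w"
proof (induction ps arbitrary: P)
  case Nil
  have "[P] = path P []" by simp
  then show ?case by blast
next
  case (Cons Q ps)
  then obtain w where "Q # ps = path Q w" by (metis successively.simps(3))
  moreover have "unit_step P Q" using Cons.prems by simp
  ultimately have "P # Q # ps = path P (True # w) \<or> P # Q # ps = path P (False # w)"
    by (auto simp: unit_step_def)
  then show ?case by blast
qed

lemma lattice_paths_eq: "lattice_paths (x, y) (x + int e, y + int m) = path (x, y) ` words e m"
proof (intro equalityI subsetI)
  fix ps assume ps: "ps \<in> lattice_paths (x, y) (x + int e, y + int m)"
  then obtain w where w: "ps = path (x, y) w"
    using successively_unit_step_imp_path[of "(x, y)" "tl ps"]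
    by (cases ps) (auto simp: lattice_paths_def)
  then have "w \<in> words e m" using ps by (auto simp: lattice_paths_def last_path words_def)
  then show "ps \<in> path (x, y) ` words e m" using w by blast
qed (auto simp: lattice_paths_def words_def last_path path_neq_Nil hd_path successively_path)

text \<open>Multiplied by \<open>c\<close>, the condition at \<open>(x, y)\<close> says that the
  integer \<open>k + a * x - c * y\<close> is positive; this is the height at that point.\<close>

lemma strictly_below_path:
  assumes "0 < c"
  shows "strictly_below (real a / real c) (real k / real c) (path P w) \<longleftrightarrow>
         stays_pos a c (int k + int a * fst P - int c * snd P) w"
proof -
  have below: "real_of_int y < real a / real c * real_of_int x + real k / real c \<longleftrightarrow>
      0 < int k + int a * x - int c * y" for x y
  proof -
    have "real_of_int y < real a / real c * real_of_int x + real k / real c \<longleftrightarrow>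
        real_of_int (int c * y) < real_of_int (int k + int a * x)"
      using assms by (simp add: field_simps)
    then show ?thesis by linarith
  qed
  show ?thesis
  proof (induction w arbitrary: P)
    case Nil
    show ?case using below by (cases P) (simp add: strictly_below_def stays_pos_Nil del: times_divide_eq_left)
  next
    case (Cons b w)
    let ?Q = "if b then (fst P + 1, snd P) else (fst P, snd P + 1)"
    have "strictly_below (real a / real c) (real k / real c) (path P (b # w)) \<longleftrightarrow>
        0 < int k + int a * fst P - int c * snd P \<and>
        strictly_below (real a / real c) (real k / real c) (path ?Q w)"
      using below by (cases P) (simp add: strictly_below_def del: times_divide_eq_left)
    then show ?case
      unfolding Cons.IH stays_pos_Cons by (simp add: weight_def algebra_simps)
  qed
qed

lemma num_paths_eq:
  assumes "0 < a" and "0 < c" and "0 < s"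
  shows "num_paths a c s k = card {w \<in> words (c * s - 1) (a * s - 1). stays_pos a c (int k) w}"
proof -
  have "lattice_paths (0, 0) (int (c * s) - 1, int (a * s) - 1) =
      path (0, 0) ` words (c * s - 1) (a * s - 1)"
    using lattice_paths_eq[of 0 0 "c * s - 1" "a * s - 1"] assms by (simp add: of_nat_diff Suc_le_eq)
  then have "{ps \<in> lattice_paths (0, 0) (int (c * s) - 1, int (a * s) - 1).
        strictly_below (real a / real c) (real k / real c) ps} =
      path (0, 0) ` {w \<in> words (c * s - 1) (a * s - 1). stays_pos a c (int k) w}"
    using strictly_below_path[OF assms(2), of a k "(0, 0)"] by auto
  then show ?thesis
    by (simp add: num_paths_def card_image inj_onI path_inject)
qed

section \<open>From the sum over \<open>k\<close> to the closed formula\<close>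

theorem theorem6p1:
  fixes a c s l :: nat
  assumes "0 < a" and "a < c" and "1 \<le> s" and "(l + 1) * a < c"
  shows "real (\<Sum>k = l * a + 1..(l + 1) * a. num_paths a c s k) =
         real (l * a + c) / real ((a + c) * s + l - 1) *
         real (((a + c) * s + l - 1) choose (a * s - 1))"
proof -
  define e m where "e = c * s - 1" and "m = a * s - 1"
  have cs: "c * s = Suc e" and as: "a * s = Suc m"
    using assms unfolding e_def m_def by auto
  \<comment> \<open>Of the \<open>l + 1\<close> prepended East steps, one crosses from
    \<open>j - a\<close> to \<open>j\<close> and the others lift the height from \<open>j\<close> to
    \<open>k = j + l * a\<close>.\<close>
  have n: "(a + c) * s + l - 1 = Suc (e + l) + m"
    using cs as by (simp add: algebra_simps)
  \<comment> \<open>The total weight is \<open>a * (c * s + l) - c * (a * s - 1)\<close>, where the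
    terms \<open>a * c * s\<close> cancel.\<close>
  have T: "int (a * Suc (e + l)) - int (c * m) = int (l * a + c)"
  proof -
    have "c * (a * s) = a * (c * s)" by simp
    then have "c * m + c = a * e + a" unfolding cs as by simp
    then have "int (c * m) = int (a * e + a) - int c" by linarith
    then show ?thesis by (simp add: algebra_simps)
  qed
  define N where "N = (\<Sum>k = l * a + 1..(l + 1) * a. num_paths a c s k)"
  have "N = (\<Sum>j = 1..a. num_paths a c s (j + l * a))"
    unfolding N_def using sum.shift_bounds_cl_nat_ivl[of _ 1 "l * a" a] by (simp add: add.commute)
  also have "\<dots> = (\<Sum>j = 1..a. card {w \<in> words (e + l) m. stays_pos a c (int j) w})"
  proof (rule sum.cong[OF refl])
    fix j assume "j \<in> {1..a}"
    \<comment> \<open>As \<open>j \<le> a\<close>, this keeps \<open>j + l * a\<close> below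
      \<open>c\<close>, so the first \<open>l\<close> steps from height \<open>j\<close> are forced
      to be East.\<close>
    moreover have "int ((l + 1) * a) < int c" using assms(4) by (simp only: of_nat_less_iff)
    then have "int (l * a) + int a < int c" by (simp add: algebra_simps)
    ultimately show "num_paths a c s (j + l * a) =
        card {w \<in> words (e + l) m. stays_pos a c (int j) w}"
      using assms num_paths_eq[of a c s "j + l * a"] card_stays_pos_forced_East[of "int j" l a c e m]
      by (simp add: e_def m_def)
  qed
  also have "\<dots> = (\<Sum>w\<in>words (Suc (e + l)) m. card (starts a c w))"
    by (rule sum_card_starts_eq_sum_card_stays_pos[symmetric])
  finally have "int (Suc (e + l) + m) * int N = int (l * a + c) * int ((Suc (e + l) + m) choose m)"
    using sum_card_starts[of "Suc (e + l)" m a c] by (simp only: T of_nat_sum)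
  then have "real (Suc (e + l) + m) * real N = real (l * a + c) * real ((Suc (e + l) + m) choose m)"
    by (metis of_nat_mult of_nat_eq_iff)
  then show ?thesis
    unfolding N_def[symmetric] n m_def[symmetric] by (simp add: field_simps del: of_nat_Suc)
qed

end
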